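(* Let $\mathbf r\in\mathbb R_{>0}^d$. If $\boldsymbol\sigma$ is a critical point of $h_{\mathbf r}$ then $\boldsymbol\sigma\in\mathbb R^d$.
   Context: Let $\ell_j(\mathbf z)=1-\sum_{i=1}^db_i^{(j)}z_i$, $1\le j\le m$, with $\mathbf b^{(j)}\in\mathbb R^d\setminus\{0\}$. For nonempty $S\subseteq\{1,\dots,m\}$, the flat $\mathcal V_S$ is $\{\mathbf z\in\mathbb C^d:\ell_k(\mathbf z)=0\ \forall k\in S\}$ when this is nonempty. Let $h_{\mathbf r}(\mathbf z)=-\sum_{j=1}^dr_j\log|z_j|$ on $(\mathbb C\setminus\{0\})^d$. A critical point of $h_{\mathbf r}$ (on a flat $\mathcal V_S$) is a point $\boldsymbol\sigma\in\mathcal V_S$ with all coordinates nonzero at which the differential of the restriction of the real-valued function $h_{\mathbf r}$ to the complex manifold $\mathcal V_S\cap(\mathbb C\setminus\{0\})^d$ is zero; equivalently, $(r_1/\sigma_1,\dots,r_d/\sigma_d)$ lies in the complex span of $\{\mathbf b^{(k)}:k\in S\}$. *)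

theory Defs
  imports "HOL-Analysis.Analysis"
begin

definition ell :: "real ^ 'd \<Rightarrow> complex ^ 'd \<Rightarrow> complex"
  where "ell c z = 1 - (\<Sum>i\<in>UNIV. complex_of_real (c $ i) * z $ i)"

definition flat :: "(nat \<Rightarrow> real ^ 'd) \<Rightarrow> nat set \<Rightarrow> (complex ^ 'd) set"
  where "flat b S = {z. \<forall>k\<in>S. ell (b k) z = 0}"

definition torus :: "(complex ^ 'd) set"
  where "torus = {z. \<forall>j. z $ j \<noteq> 0}"

definition height :: "real ^ 'd \<Rightarrow> complex ^ 'd \<Rightarrow> real"
  where "height r z = - (\<Sum>j\<in>UNIV. r $ j * ln (cmod (z $ j)))"

(* The derivative is the real Frechet derivative, and it is taken within V, so that only the
   restriction of the height function to V matters.  For a flat V, which is an affine subspace,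
   any derivative within V is determined on the direction space of V, and the zero map is one
   of them exactly if the differential of the restriction vanishes on the tangent space.  If V is
   a single point, that tangent space is zero and the point is critical, as it should be. *)
definition critical_point_on ::
    "real ^ 'd \<Rightarrow> (complex ^ 'd) set \<Rightarrow> complex ^ 'd \<Rightarrow> bool"
  where "critical_point_on r V \<sigma> \<longleftrightarrow>
    \<sigma> \<in> V \<inter> torus \<and>
    (height r has_derivative (\<lambda>_. 0)) (at \<sigma> within V \<inter> torus)"

end

theory Submission
  imports Defs
begin

text \<open>
  Stretching the imaginary parts of \<open>\<sigma>\<close>, that is moving along \<open>t \<mapsto> Re \<sigma> + \<i> (1 + t) Im \<sigma>\<close>,
  stays in every flat through \<open>\<sigma>\<close>: the flats are cut out by real equations, so \<open>Im \<sigma>\<close> is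
  annihilated by their linear parts (\<open>ell_imag_stretch\<close>). For \<open>t > - 1\<close> no coordinate vanishes
  on the way (\<open>torus_imag_stretch\<close>). At \<open>t = 0\<close>, \<open>ln |z\<^sub>j|\<close> changes at the rate \<open>(Im \<sigma>\<^sub>j)\<^sup>2 / |\<sigma>\<^sub>j|\<^sup>2\<close>,
  so the height changes at the rate \<open>- (\<Sum>\<^sub>j r\<^sub>j (Im \<sigma>\<^sub>j)\<^sup>2 / |\<sigma>\<^sub>j|\<^sup>2)\<close>
  (\<open>height_imag_stretch_deriv\<close>). If \<open>\<sigma>\<close> is critical this sum is zero; as the weights \<open>r\<^sub>j\<close> are positive, every \<open>Im \<sigma>\<^sub>j\<close> is zero.
\<close>

definition imag_dir :: "complex ^ 'd \<Rightarrow> complex ^ 'd"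
  where "imag_dir z = (\<chi> j. \<i> * complex_of_real (Im (z $ j)))"

lemma ell_imag_stretch:
  assumes "ell c z = 0"
  shows "ell c (z + t *\<^sub>R imag_dir z) = 0"
proof -
  have re: "(\<Sum>i\<in>UNIV. c $ i * Re (z $ i)) = 1" and im: "(\<Sum>i\<in>UNIV. c $ i * Im (z $ i)) = 0"
    using assms by (simp_all add: ell_def complex_eq_iff)
  have "(\<Sum>i\<in>UNIV. c $ i * (Im (z $ i) + t * Im (z $ i))) = (1 + t) * (\<Sum>i\<in>UNIV. c $ i * Im (z $ i))"
    by (simp add: sum_distrib_left algebra_simps sum.distrib)
  with re im show ?thesis
    by (simp add: ell_def imag_dir_def complex_eq_iff)
qed

lemma torus_imag_stretch:
  assumes "z \<in> torus" and "t > - 1"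
  shows "z + t *\<^sub>R imag_dir z \<in> torus"
proof -
  have "Im (z $ j) + t * Im (z $ j) = (1 + t) * Im (z $ j)" for j
    by (simp add: algebra_simps)
  with assms show ?thesis
    by (auto simp: torus_def imag_dir_def complex_eq_iff)
qed

lemma ln_cmod_imag_stretch_deriv:
  assumes "w \<noteq> 0"
  shows "((\<lambda>t. ln (cmod (w + t *\<^sub>R (\<i> * complex_of_real (Im w)))))
           has_real_derivative (Im w)\<^sup>2 / (cmod w)\<^sup>2) (at 0)"
proof -
  have pos: "0 < (Re w)\<^sup>2 + (Im w)\<^sup>2"
    using assms by (simp add: sum_power2_gt_zero_iff complex_eq_iff)
  have "((\<lambda>t. ln (sqrt ((Re w)\<^sup>2 + (Im w + t * Im w)\<^sup>2)))
           has_real_derivative (Im w)\<^sup>2 / ((Re w)\<^sup>2 + (Im w)\<^sup>2)) (at 0)"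
    using pos by (auto intro!: derivative_eq_intros simp: field_simps power2_eq_square)
  then show ?thesis
    by (simp add: norm_complex_def)
qed

lemma height_imag_stretch_deriv:
  assumes "z \<in> torus"
  shows "((\<lambda>t. height r (z + t *\<^sub>R imag_dir z))
           has_real_derivative - (\<Sum>j\<in>UNIV. r $ j * ((Im (z $ j))\<^sup>2 / (cmod (z $ j))\<^sup>2))) (at 0)"
proof -
  have "z $ j \<noteq> 0" for j
    using assms by (simp add: torus_def)
  note d = ln_cmod_imag_stretch_deriv[OF this]
  show ?thesis
    unfolding height_def imag_dir_def vector_add_component vector_scaleR_component vec_lambda_beta
    by (intro DERIV_minus DERIV_sum DERIV_cmult d)
qed

text \<open>
  Once the stretching curve lies in \<open>V\<close>, the chain rule makes the height along it stationary at
  \<open>\<sigma>\<close>, so the rate of change computed above must vanish. This does not depend on \<open>V\<close> being affine.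
\<close>

lemma critical_point_imag_energy_eq_0:
  assumes crit: "critical_point_on r V \<sigma>"
    and stretch: "\<And>t. \<sigma> + t *\<^sub>R imag_dir \<sigma> \<in> V"
  shows "(\<Sum>j\<in>UNIV. r $ j * ((Im (\<sigma> $ j))\<^sup>2 / (cmod (\<sigma> $ j))\<^sup>2)) = 0"
proof -
  let ?\<gamma> = "\<lambda>t::real. \<sigma> + t *\<^sub>R imag_dir \<sigma>"
  have tor: "\<sigma> \<in> torus"
    and dh: "(height r has_derivative (\<lambda>_. 0)) (at \<sigma> within V \<inter> torus)"
    using crit by (auto simp: critical_point_on_def)
  \<comment> \<open>At \<open>t = - 1\<close> the curve can leave the torus, at a coordinate of \<open>\<sigma>\<close> that is purely imaginary.\<close>
  have "?\<gamma> ` {-1<..} \<subseteq> V \<inter> torus"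
    using stretch torus_imag_stretch[OF tor] by auto
  then have dh': "(height r has_derivative (\<lambda>_. 0)) (at (?\<gamma> 0) within ?\<gamma> ` {-1<..})"
    using has_derivative_subset[OF dh] by simp
  have "(?\<gamma> has_derivative (\<lambda>t. t *\<^sub>R imag_dir \<sigma>)) (at 0 within {-1<..})"
    by (auto intro!: derivative_eq_intros)
  from has_derivative_in_compose[OF this dh']
  have "((\<lambda>t. height r (?\<gamma> t)) has_derivative (\<lambda>_. 0)) (at 0)"
    by (simp add: at_within_open[of 0 "{-1<..}"])
  then have "((\<lambda>t. height r (?\<gamma> t)) has_real_derivative 0) (at 0)"
    by (simp add: has_field_derivative_def lambda_zero[symmetric])
  from DERIV_unique[OF this height_imag_stretch_deriv[OF tor]] show ?thesis
    by simp
qed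

theorem lemma3p3:
  fixes b :: "nat \<Rightarrow> real ^ 'd" and m :: nat and S :: "nat set"
    and r :: "real ^ 'd" and \<sigma> :: "complex ^ 'd"
  assumes "\<forall>j\<in>{1..m}. b j \<noteq> 0"
    and "\<forall>i. r $ i > 0"
    and "S \<noteq> {}" and "S \<subseteq> {1..m}"
    and "critical_point_on r (flat b S) \<sigma>"
  shows "\<forall>i. \<sigma> $ i \<in> \<real>"
proof
  fix i
  have "\<sigma> \<in> flat b S" and nz: "\<sigma> $ i \<noteq> 0"
    using assms(5) by (auto simp: critical_point_on_def torus_def)
  then have "\<sigma> + t *\<^sub>R imag_dir \<sigma> \<in> flat b S" for t
    by (simp add: flat_def ell_imag_stretch)
  from critical_point_imag_energy_eq_0[OF assms(5) this]
  have "r $ i * ((Im (\<sigma> $ i))\<^sup>2 / (cmod (\<sigma> $ i))\<^sup>2) = 0"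
    using assms(2) by (subst (asm) sum_nonneg_eq_0_iff) (auto simp: less_imp_le)
  moreover have "r $ i \<noteq> 0"
    using assms(2) by (metis less_irrefl)
  ultimately show "\<sigma> $ i \<in> \<real>"
    using nz by (simp add: complex_is_Real_iff)
qed

end
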